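(* For every real number $t\geqslant0$, the sequence of polynomials $\{B_n(q;t)\}_{n\geqslant0}$ in $q$ is strongly $q$-log-convex.
   Context: $B_n$ is the group of signed permutations of $\{1,\dots,n\}$, i.e. bijections $\pi$ of $\{\pm1,\dots,\pm n\}$ with $\pi(-i)=-\pi(i)$. With $\pi(0):=0$, let $d_B(\pi)=|\{i\in\{0,1,\dots,n-1\}:\pi(i)>\pi(i+1)\}|$ be the number of $B$-descents and $N(\pi)=|\{i\in\{1,\dots,n\}:\pi(i)<0\}|$. Define $B_n(q;t):=\sum_{\pi\in B_n}q^{d_B(\pi)}t^{N(\pi)}$, with $B_0(q;t)=1$. Equivalently, as formal power series in $x$, $$\sum_{n\geqslant0}B_n(q;t)\frac{x^n}{n!}=\frac{(1-q)e^{x(1-q)}}{1-qe^{x(1-q)(1+t)}} .$$ For real polynomials $f(q),g(q)$, write $f(q)\geqslant_q g(q)$ if $f(q)-g(q)$ has only nonnegative coefficients as a polynomial in $q$. A sequence $\{f_n(q)\}_{n\geqslant0}$ of real polynomials is strongly $q$-log-convex if $f_{m-1}(q)f_{n+1}(q)\geqslant_q f_m(q)f_n(q)$ for all $n\geqslant m\geqslant 1$. *)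

theory Defs
  imports
    "HOL-Combinatorics.Permutations"
    "HOL-Computational_Algebra.Polynomial"
begin

(* Since permutes makes a permutation the identity outside the given set, every element
   satisfies \<pi> 0 = 0, which is the convention used in counting B-descents. *)
definition signed_perms :: "nat \<Rightarrow> (int \<Rightarrow> int) set" where
  "signed_perms n =
     {\<pi>. \<pi> permutes ({- int n..int n} - {0}) \<and>
         (\<forall>i \<in> {- int n..int n} - {0}. \<pi> (- i) = - \<pi> i)}"

definition B_descents :: "nat \<Rightarrow> (int \<Rightarrow> int) \<Rightarrow> nat" where
  "B_descents n \<pi> = card {i \<in> {0..int n - 1}. \<pi> i > \<pi> (i + 1)}"

definition neg_count :: "nat \<Rightarrow> (int \<Rightarrow> int) \<Rightarrow> nat" where
  "neg_count n \<pi> = card {i \<in> {1..int n}. \<pi> i < 0}"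

(* Polynomial in q; the parameter t is a real number. *)
definition B_poly :: "real \<Rightarrow> nat \<Rightarrow> real poly" where
  "B_poly t n = (\<Sum>\<pi>\<in>signed_perms n. monom (t ^ neg_count n \<pi>) (B_descents n \<pi>))"

definition q_ge :: "real poly \<Rightarrow> real poly \<Rightarrow> bool" (infix "\<ge>\<^sub>q" 50) where
  "f \<ge>\<^sub>q g \<longleftrightarrow> (\<forall>k. coeff (f - g) k \<ge> 0)"

definition strongly_q_log_convex :: "(nat \<Rightarrow> real poly) \<Rightarrow> bool" where
  "strongly_q_log_convex f \<longleftrightarrow>
     (\<forall>m n. 1 \<le> m \<and> m \<le> n \<longrightarrow> f (m - 1) * f (n + 1) \<ge>\<^sub>q f m * f n)"

lemma finite_signed_perms: "finite (signed_perms n)"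
  unfolding signed_perms_def
  by (rule finite_subset[OF _ finite_permutations[of "{- int n..int n} - {0}"]]) auto

lemma signed_perms_at_0: "\<pi> \<in> signed_perms n \<Longrightarrow> \<pi> 0 = 0"
  by (auto simp: signed_perms_def permutes_def)

lemma B_poly_0: "B_poly t 0 = 1"
proof -
  have "signed_perms 0 = {id}"
    by (auto simp: signed_perms_def)
  then show ?thesis
    by (simp add: B_poly_def B_descents_def neg_count_def)
qed

end

theory Submission imports Defs begin

text \<open>
  Write \<open>c = 1 + t\<close>. The proof rests on the Jacobi continued fraction of
  \<open>\<Sum>\<^sub>n B\<^sub>n(q;t) x\<^sup>n\<close>, whose parameters are
  \<open>s\<^sub>k = k c (1 + q) + 1 + q t\<close> on the diagonal and
  \<open>l\<^sub>k = (k + 1)\<^sup>2 c\<^sup>2 q\<close> off it. In terms of weighted Motzkin paths, there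
  is an infinite triangle \<open>A\<^sub>n\<^sub>,\<^sub>k\<close> with
  \<open>A\<^sub>n\<^sub>+\<^sub>1\<^sub>,\<^sub>k = A\<^sub>n\<^sub>,\<^sub>k\<^sub>-\<^sub>1 + s\<^sub>k A\<^sub>n\<^sub>,\<^sub>k + l\<^sub>k A\<^sub>n\<^sub>,\<^sub>k\<^sub>+\<^sub>1\<close>
  whose column \<open>0\<close> consists of the polynomials \<open>B\<^sub>n(q;t)\<close>.

  For any such triangle, reading a path of length \<open>i + j\<close> from both ends gives
  \<open>A\<^sub>i\<^sub>+\<^sub>j\<^sub>,\<^sub>0 = \<Sum>\<^sub>k l\<^sub>0 \<cdots> l\<^sub>k\<^sub>-\<^sub>1 A\<^sub>i\<^sub>,\<^sub>k A\<^sub>j\<^sub>,\<^sub>k\<close>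
  (\<open>jacobi_moment_decomposition\<close>). With \<open>p = m - 1\<close> and \<open>d = n - p\<close> it follows that
  \<open>A\<^sub>p\<^sub>,\<^sub>0 A\<^sub>n\<^sub>+\<^sub>1\<^sub>,\<^sub>0 - A\<^sub>m\<^sub>,\<^sub>0 A\<^sub>n\<^sub>,\<^sub>0\<close> is the sum over \<open>k\<close> of
  \<open>l\<^sub>0 \<cdots> l\<^sub>k\<^sub>-\<^sub>1 A\<^sub>d\<^sub>,\<^sub>k\<close> times the minor of the consecutive rows \<open>p\<close>, \<open>m\<close> in the columns
  \<open>0\<close>, \<open>k\<close>. All minors of consecutive rows have nonnegative coefficients as soon as
  \<open>s\<^sub>k s\<^sub>k\<^sub>+\<^sub>1 - l\<^sub>k\<close> does (\<open>jacobi_consecutive_minors_nonneg\<close>), because passing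
  to the next pair of rows multiplies by a tridiagonal matrix that is then totally positive of
  order two. For the parameters above, the only coefficient of \<open>s\<^sub>k s\<^sub>k\<^sub>+\<^sub>1 - l\<^sub>k\<close> that
  involves a subtraction is that of \<open>q\<close>, and it equals \<open>c\<^sup>2 (k\<^sup>2 + 2 k) + 2 t\<close>.

  That column \<open>0\<close> is \<open>B\<^sub>n(q;t)\<close> follows from comparing recurrences. Inserting the letter
  \<open>n + 1\<close> or \<open>-(n + 1)\<close> into a signed permutation of \<open>n\<close> letters yields
  \<open>B\<^sub>n\<^sub>+\<^sub>1 = (1 + (c n + t) q) B\<^sub>n + c (q - q\<^sup>2) B\<^sub>n'\<close> (\<open>B_poly_recurrence\<close>). The triangle obeys
  the same recurrence in its column \<open>0\<close> because of the differential relation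
  \<open>(1 - q) A\<^sub>n\<^sub>,\<^sub>k' = (k - n) A\<^sub>n\<^sub>,\<^sub>k + c (k + 1)\<^sup>2 A\<^sub>n\<^sub>,\<^sub>k\<^sub>+\<^sub>1\<close> (\<open>B_triangle_derivative\<close>).
\<close>

section \<open>Polynomials with nonnegative coefficients\<close>

definition nonneg_coeffs :: "real poly \<Rightarrow> bool" where
  "nonneg_coeffs p \<longleftrightarrow> (\<forall>k. coeff p k \<ge> 0)"

lemma q_ge_iff_nonneg_coeffs: "f \<ge>\<^sub>q g \<longleftrightarrow> nonneg_coeffs (f - g)"
  by (simp add: q_ge_def nonneg_coeffs_def)

lemma nonneg_coeffs_0 [simp]: "nonneg_coeffs 0"
  by (simp add: nonneg_coeffs_def)

lemma nonneg_coeffs_1 [simp]: "nonneg_coeffs 1"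
  by (simp add: nonneg_coeffs_def)

lemma nonneg_coeffs_add [intro]:
  "nonneg_coeffs p \<Longrightarrow> nonneg_coeffs q \<Longrightarrow> nonneg_coeffs (p + q)"
  by (simp add: nonneg_coeffs_def)

lemma nonneg_coeffs_mult [intro]:
  "nonneg_coeffs p \<Longrightarrow> nonneg_coeffs q \<Longrightarrow> nonneg_coeffs (p * q)"
  by (auto simp: nonneg_coeffs_def coeff_mult intro!: sum_nonneg)

lemma nonneg_coeffs_sum [intro]:
  "(\<And>x. x \<in> A \<Longrightarrow> nonneg_coeffs (f x)) \<Longrightarrow> nonneg_coeffs (sum f A)"
  by (induction A rule: infinite_finite_induct) auto

lemma nonneg_coeffs_prod [intro]:
  "(\<And>x. x \<in> A \<Longrightarrow> nonneg_coeffs (f x)) \<Longrightarrow> nonneg_coeffs (prod f A)"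
  by (induction A rule: infinite_finite_induct) auto

lemma nonneg_coeffs_pCons [simp]:
  "nonneg_coeffs (pCons a p) \<longleftrightarrow> a \<ge> 0 \<and> nonneg_coeffs p"
  unfolding nonneg_coeffs_def
  by (metis coeff_pCons_0 coeff_pCons_Suc not0_implies_Suc)

section \<open>The triangle of a Jacobi continued fraction\<close>

text \<open>
  The entry in row \<open>n\<close> and column \<open>k\<close> is the total weight of the Motzkin paths of length \<open>n\<close> from
  height \<open>0\<close> to height \<open>k\<close>, where up steps have weight \<open>1\<close>, a level step at height \<open>j\<close> has weight
  \<open>s j\<close>, and a down step from \<open>j + 1\<close> to \<open>j\<close> has weight \<open>l j\<close>. Column \<open>0\<close> is the moment sequence
  of the continued fraction.
\<close>
primrec jacobi_triangle ::
  "(nat \<Rightarrow> 'a) \<Rightarrow> (nat \<Rightarrow> 'a) \<Rightarrow> nat \<Rightarrow> nat \<Rightarrow> 'a::comm_ring_1"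
where
  "jacobi_triangle s l 0 k = (if k = 0 then 1 else 0)"
| "jacobi_triangle s l (Suc n) k =
     (case k of 0 \<Rightarrow> 0 | Suc j \<Rightarrow> jacobi_triangle s l n j) +
     s k * jacobi_triangle s l n k + l k * jacobi_triangle s l n (Suc k)"

lemma jacobi_triangle_eq_0: "n < k \<Longrightarrow> jacobi_triangle s l n k = 0"
  by (induction n arbitrary: k) (auto split: nat.split)

lemma jacobi_triangle_nonneg:
  assumes "\<And>k. nonneg_coeffs (s k)" "\<And>k. nonneg_coeffs (l k)"
  shows "nonneg_coeffs (jacobi_triangle s l n k)"
  by (induction n arbitrary: k)
     (auto intro!: nonneg_coeffs_add nonneg_coeffs_mult assms split: nat.split)

text \<open>
  With the weights \<open>l 0 \<cdots> l (k - 1)\<close> the tridiagonal step matrix becomes symmetric, so moving one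
  step from one row to the other changes the weighted inner product of two rows only by the
  boundary term of a truncated sum: the summands telescope, as in the Christoffel-Darboux formula.
\<close>
lemma jacobi_christoffel_darboux:
  fixes s l :: "nat \<Rightarrow> 'a::comm_ring_1"
  defines "A \<equiv> jacobi_triangle s l"
  shows "(\<Sum>k\<le>N. prod l {..<k} * (A (Suc i) k * A j k - A i k * A (Suc j) k)) =
    prod l {..<Suc N} * (A i (Suc N) * A j N - A i N * A j (Suc N))"
  by (induction N) (simp_all add: A_def algebra_simps)

text \<open>
  Combinatorially, a path of length \<open>i + j\<close> from height \<open>0\<close> to \<open>0\<close> is cut after \<open>i\<close> steps, at some
  height \<open>k\<close>; reversing the second part exchanges up and down steps, which costs the factor
  \<open>l 0 \<cdots> l (k - 1)\<close>. Algebraically, the boundary term above vanishes once \<open>N\<close> is at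
  least both row indices, so steps can be moved from row \<open>i\<close> to row \<open>j\<close> until row \<open>0\<close> remains.
\<close>
lemma jacobi_moment_decomposition:
  assumes "i + j \<le> N"
  shows "jacobi_triangle s l (i + j) 0 =
    (\<Sum>k\<le>N. prod l {..<k} * (jacobi_triangle s l i k * jacobi_triangle s l j k))"
  using assms
proof (induction i arbitrary: j)
  case 0
  have "(\<Sum>k\<le>N. prod l {..<k} * (jacobi_triangle s l 0 k * jacobi_triangle s l j k)) =
    (\<Sum>k\<le>N. if k = 0 then jacobi_triangle s l j 0 else 0)"
    by (intro sum.cong) auto
  then show ?case by simp
next
  case (Suc i)
  let ?A = "jacobi_triangle s l"
  have "(\<Sum>k\<le>N. prod l {..<k} * (?A (Suc i) k * ?A j k - ?A i k * ?A (Suc j) k)) = 0"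
    unfolding jacobi_christoffel_darboux using Suc.prems by (simp add: jacobi_triangle_eq_0 del: jacobi_triangle.simps)
  then have "(\<Sum>k\<le>N. prod l {..<k} * (?A (Suc i) k * ?A j k)) =
    (\<Sum>k\<le>N. prod l {..<k} * (?A i k * ?A (Suc j) k))"
    by (simp add: right_diff_distrib sum_subtractf del: jacobi_triangle.simps)
  then show ?case using Suc.IH[of "Suc j"] Suc.prems by (simp del: jacobi_triangle.simps)
qed

text \<open>
  By induction on \<open>n\<close>. Expanding the next minor bilinearly expresses it in minors of the present
  two rows, in columns from \<open>{a - 1, a, a + 1}\<close> and \<open>{b - 1, b, b + 1}\<close>. These columns come in the
  right order, or coincide and give \<open>0\<close>, except in one case: for \<open>b = a + 1\<close> the columns
  \<open>a + 1\<close>, \<open>a\<close> contribute \<open>- l a\<close> times the minor in columns \<open>a\<close>, \<open>a + 1\<close>, and this is absorbed by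
  the contribution \<open>s a * s (a + 1)\<close> of the same minor.
\<close>
lemma jacobi_consecutive_minors_nonneg:
  assumes s: "\<And>k. nonneg_coeffs (s k)" and l: "\<And>k. nonneg_coeffs (l k)"
    and sl: "\<And>k. nonneg_coeffs (s k * s (Suc k) - l k)"
  defines "A \<equiv> jacobi_triangle s l"
  shows "a \<le> b \<Longrightarrow> nonneg_coeffs (A n a * A (Suc n) b - A (Suc n) a * A n b)"
proof (induction n arbitrary: a b)
  case 0
  show ?case
  proof (cases "a = b")
    case False
    then show ?thesis using 0 jacobi_triangle_nonneg[of s l "Suc 0" b, OF s l]
      by (auto simp: A_def)
  qed (simp add: A_def algebra_simps)
next
  case (Suc n)
  define u where "u k = A n k" for k
  define v where "v k = A (Suc n) k" for k
  \<comment> \<open>The rows shifted by one column, with the value \<open>0\<close> in the column before the first.\<close>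
  define u' where "u' k = (case k of 0 \<Rightarrow> 0 | Suc j \<Rightarrow> u j)" for k
  define v' where "v' k = (case k of 0 \<Rightarrow> 0 | Suc j \<Rightarrow> v j)" for k
  have stepu: "A (Suc n) k = u' k + s k * u k + l k * u (Suc k)" for k
    by (simp add: A_def u_def u'_def split: nat.split)
  have stepv: "A (Suc (Suc n)) k = v' k + s k * v k + l k * v (Suc k)" for k
    unfolding A_def jacobi_triangle.simps(2)[of s l "Suc n"]
    by (simp add: A_def v_def v'_def split: nat.split)
  have uv: "nonneg_coeffs (u a * v b - v a * u b)" if "a \<le> b" for a b
    using Suc.IH[OF that] by (simp add: u_def v_def)
  have u'v: "nonneg_coeffs (u' a * v b - v' a * u b)" if "a \<le> Suc b" for a b
    using uv that by (auto simp: u'_def v'_def split: nat.split)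
  have uv': "nonneg_coeffs (u a * v' b - v a * u' b)" if "a < b" for a b
    using uv that by (auto simp: u'_def v'_def split: nat.split)
  have u'v': "nonneg_coeffs (u' a * v' b - v' a * u' b)" if "a \<le> b" for a b
    using uv that by (auto simp: u'_def v'_def split: nat.split)
  consider "a = b" | "b = Suc a" | "Suc (Suc a) \<le> b" using Suc.prems by linarith
  then show ?case
  proof cases
    case 1
    then show ?thesis by (simp add: mult.commute)
  next
    case 2
    have *: "A (Suc n) a * A (Suc (Suc n)) b - A (Suc (Suc n)) a * A (Suc n) b =
      (u' a * v' b - v' a * u' b) + s b * (u' a * v b - v' a * u b)
      + l b * (u' a * v (Suc b) - v' a * u (Suc b))
      + (s a * s (Suc a) - l a) * (u a * v b - v a * u b)
      + s a * l b * (u a * v (Suc b) - v a * u (Suc b))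
      + l a * l b * (u (Suc a) * v (Suc b) - v (Suc a) * u (Suc b))"
      unfolding stepu stepv using 2
      by (simp add: u'_def v'_def algebra_simps)
    show ?thesis unfolding *
      using 2 by (intro nonneg_coeffs_add nonneg_coeffs_mult s l sl uv u'v u'v') auto
  next
    case 3
    have *: "A (Suc n) a * A (Suc (Suc n)) b - A (Suc (Suc n)) a * A (Suc n) b =
      (u' a * v' b - v' a * u' b) + s b * (u' a * v b - v' a * u b)
      + l b * (u' a * v (Suc b) - v' a * u (Suc b))
      + s a * (u a * v' b - v a * u' b) + s a * s b * (u a * v b - v a * u b)
      + s a * l b * (u a * v (Suc b) - v a * u (Suc b))
      + l a * (u (Suc a) * v' b - v (Suc a) * u' b)
      + l a * s b * (u (Suc a) * v b - v (Suc a) * u b)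
      + l a * l b * (u (Suc a) * v (Suc b) - v (Suc a) * u (Suc b))"
      unfolding stepu stepv by (simp add: algebra_simps)
    show ?thesis unfolding *
      using 3 by (intro nonneg_coeffs_add nonneg_coeffs_mult s l uv u'v uv' u'v') auto
  qed
qed

text \<open>
  Decomposing \<open>n + 1 = d + (p + 1)\<close> and \<open>n = d + p\<close> with the same \<open>d\<close> puts a minor of the
  consecutive rows \<open>p\<close> and \<open>p + 1 = m\<close> into every summand.
\<close>
theorem jacobi_moments_strongly_q_log_convex:
  assumes s: "\<And>k. nonneg_coeffs (s k)" and l: "\<And>k. nonneg_coeffs (l k)"
    and sl: "\<And>k. nonneg_coeffs (s k * s (Suc k) - l k)"
  shows "strongly_q_log_convex (\<lambda>n. jacobi_triangle s l n 0)"
  unfolding strongly_q_log_convex_def q_ge_iff_nonneg_coeffs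
proof (intro allI impI, elim conjE)
  fix m n :: nat
  assume "1 \<le> m" "m \<le> n"
  then obtain p where p: "m = Suc p" by (cases m) auto
  define d where "d = n - p"
  let ?A = "jacobi_triangle s l"
  have n: "n = d + p" "n + 1 = d + Suc p"
    using \<open>m \<le> n\<close> p by (auto simp: d_def)
  have "?A p 0 * ?A (d + Suc p) 0 - ?A (Suc p) 0 * ?A (d + p) 0 =
    (\<Sum>k\<le>d + Suc p. prod l {..<k} * (?A d k * (?A p 0 * ?A (Suc p) k - ?A (Suc p) 0 * ?A p k)))"
    unfolding jacobi_moment_decomposition[of d "Suc p" "d + Suc p", OF order_refl]
      jacobi_moment_decomposition[of d p "d + Suc p", OF add_left_mono[OF le_SucI[OF order_refl]]]
      sum_distrib_left sum_subtractf[symmetric]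
    by (intro sum.cong refl) (simp add: algebra_simps del: jacobi_triangle.simps)
  moreover have "nonneg_coeffs \<dots>"
    by (intro nonneg_coeffs_sum nonneg_coeffs_mult nonneg_coeffs_prod l
          jacobi_triangle_nonneg s jacobi_consecutive_minors_nonneg sl) auto
  ultimately show "nonneg_coeffs (?A (m - 1) 0 * ?A (n + 1) 0 - ?A m 0 * ?A n 0)"
    by (simp add: n p del: jacobi_triangle.simps)
qed

section \<open>The Jacobi parameters of the Eulerian polynomials of type B\<close>

definition B_diag :: "real \<Rightarrow> nat \<Rightarrow> real poly" where
  "B_diag t k = [:real k * (1 + t) + 1, real k * (1 + t) + t:]"

definition B_offdiag :: "real \<Rightarrow> nat \<Rightarrow> real poly" where
  "B_offdiag t k = [:0, (real (Suc k) * (1 + t))\<^sup>2:]"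

text \<open>
  The exponential generating function of column \<open>k\<close> is \<open>f g\<^sup>k / k!\<close>, where \<open>f\<close> is that of
  \<open>B\<^sub>n(q;t)\<close> and \<open>g = (E - 1) / (c (1 - q E))\<close> with \<open>E = e\<^bsup>c x (1 - q)\<^esup>\<close>. The first-order
  operator \<open>(1 - c q x) \<partial>\<^sub>x - c (q - q\<^sup>2) \<partial>\<^sub>q\<close> maps \<open>g\<close> to \<open>1 + c g\<close> and \<open>f\<close> to \<open>(1 + t q) f\<close>;
  extracting coefficients and cancelling \<open>c q\<close> gives the relation below. With the relation
  known, induction on \<open>n\<close> is enough: the terms cancel column by column
  (\<open>coeff0\<close>, \<open>coeff1\<close>, \<open>coeff2\<close>).
\<close>
lemma B_triangle_derivative:
  fixes t :: real
  defines "A \<equiv> jacobi_triangle (B_diag t) (B_offdiag t)"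
  shows "[:1, -1:] * pderiv (A n k) =
    [:real k - real n:] * A n k + [:(1 + t) * (real (Suc k))\<^sup>2:] * A n (Suc k)"
proof (induction n arbitrary: k)
  case 0
  show ?case by (simp add: A_def)
next
  case (Suc n)
  define c where "c = 1 + t"
  define p where "p = (case k of 0 \<Rightarrow> 0 | Suc j \<Rightarrow> A n j)"
  have step: "A (Suc n) k = p + B_diag t k * A n k + B_offdiag t k * A n (Suc k)"
    by (simp add: A_def p_def split: nat.split)
  have step': "A (Suc n) (Suc k) =
      A n k + B_diag t (Suc k) * A n (Suc k) + B_offdiag t (Suc k) * A n (Suc (Suc k))"
    by (simp add: A_def)
  have IHp: "[:1, -1:] * pderiv p = [:real k - 1 - real n:] * p + [:c * (real k)\<^sup>2:] * A n k"
    using Suc.IH[of "k - 1"] by (cases k) (simp_all add: p_def c_def)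
  have s': "pderiv (B_diag t k) = [:real k * c + t:]"
    by (simp add: B_diag_def c_def pderiv_pCons)
  have l': "pderiv (B_offdiag t k) = [:(real (Suc k) * c)\<^sup>2:]"
    by (simp add: B_offdiag_def c_def pderiv_pCons)
  have coeff0: "[:c * (real k)\<^sup>2:] + [:1,-1:] * [:real k * c + t:] + B_diag t k
      - [:c * (real (Suc k))\<^sup>2:] = 0"
    by (simp add: B_diag_def c_def algebra_simps power2_eq_square)
  have coeff1: "[:c * (real (Suc k))\<^sup>2:] * B_diag t k + [:1,-1:] * [:(real (Suc k) * c)\<^sup>2:]
      + 2 * B_offdiag t k - [:c * (real (Suc k))\<^sup>2:] * B_diag t (Suc k) = 0"
    by (simp add: B_diag_def B_offdiag_def c_def numeral_poly algebra_simps power2_eq_square)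
  have coeff2: "B_offdiag t k * [:c * (real (Suc (Suc k)))\<^sup>2:] =
      [:c * (real (Suc k))\<^sup>2:] * B_offdiag t (Suc k)"
    by (simp add: B_offdiag_def c_def algebra_simps power2_eq_square)
  \<comment> \<open>The cancellation with abstract coefficients, which keeps the concrete polynomials from being
    multiplied out.\<close>
  have ring: "X * (dp + S' * a + S * da + L' * b + L * db) =
      (K - 1) * (p + S * a + L * b) + C * (a + S1 * b + L1 * d)"
    if "X * dp = (K - 1) * p + C0 * a" "X * da = K * a + C * b" "X * db = (K + 1) * b + C2 * d"
      "C0 + X * S' + S - C = 0" "C * S + X * L' + 2 * L - C * S1 = 0" "L * C2 = C * L1"
    for X dp S' a S da L' b L db K p C S1 L1 d C0 C2 :: "real poly"
  proof -
    have "X * (dp + S' * a + S * da + L' * b + L * db) -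
        ((K - 1) * (p + S * a + L * b) + C * (a + S1 * b + L1 * d)) =
      (X * dp - ((K - 1) * p + C0 * a)) + S * (X * da - (K * a + C * b))
      + L * (X * db - ((K + 1) * b + C2 * d)) + a * (C0 + X * S' + S - C)
      + b * (C * S + X * L' + 2 * L - C * S1) + d * (L * C2 - C * L1)"
      by (simp add: algebra_simps)
    also have "\<dots> = 0" unfolding that by simp
    finally show ?thesis by simp
  qed
  have K: "[:real k - 1 - real n:] = [:real k - real n:] - 1"
    "[:real k - real (Suc n):] = [:real k - real n:] - 1"
    "[:real (Suc k) - real n:] = [:real k - real n:] + 1"
    by (simp_all add: one_pCons)
  have deriv: "pderiv (A (Suc n) k) = pderiv p + [:real k * c + t:] * A n k
      + B_diag t k * pderiv (A n k) + [:(real (Suc k) * c)\<^sup>2:] * A n (Suc k)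
      + B_offdiag t k * pderiv (A n (Suc k))"
    unfolding step pderiv_add pderiv_mult s' l' by (simp only: ac_simps)
  have "[:1, -1:] * pderiv (A (Suc n) k) =
    ([:real k - real n:] - 1) * A (Suc n) k + [:c * (real (Suc k))\<^sup>2:] * A (Suc n) (Suc k)"
    unfolding deriv unfolding step step'
    by (rule ring[OF IHp[unfolded K] Suc.IH[of k, folded c_def]
        Suc.IH[of "Suc k", folded c_def, unfolded K] coeff0 coeff1 coeff2])
  then show ?case unfolding K c_def .
qed

lemma B_triangle_recurrence:
  fixes t :: real
  defines "A \<equiv> jacobi_triangle (B_diag t) (B_offdiag t)"
  shows "A (Suc n) 0 = [:1, (1 + t) * real n + t:] * A n 0 + [:0, 1 + t, - (1 + t):] * pderiv (A n 0)"
proof -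
  have split: "[:0, 1 + t, - (1 + t):] = [:0, 1 + t:] * [:1, -1:]"
    by simp
  have diag: "[:1, (1 + t) * real n + t:] + [:0, 1 + t:] * [:real 0 - real n:] = B_diag t 0"
    by (simp add: B_diag_def)
  have offdiag: "[:0, 1 + t:] * [:(1 + t) * (real (Suc 0))\<^sup>2:] = B_offdiag t 0"
    by (simp add: B_offdiag_def power2_eq_square)
  have "[:1, (1 + t) * real n + t:] * A n 0 + [:0, 1 + t, - (1 + t):] * pderiv (A n 0) =
      ([:1, (1 + t) * real n + t:] + [:0, 1 + t:] * [:real 0 - real n:]) * A n 0
      + [:0, 1 + t:] * [:(1 + t) * (real (Suc 0))\<^sup>2:] * A n (Suc 0)"
    unfolding split mult.assoc[of "[:0, 1 + t:]"] B_triangle_derivative[of t n 0, folded A_def]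
    by (simp only: distrib_left distrib_right mult.assoc add.assoc)
  then show ?thesis unfolding diag offdiag by (simp add: A_def)
qed

section \<open>Signed permutations as words\<close>

definition signed_words :: "nat \<Rightarrow> int list set" where
  "signed_words n = {xs. distinct (map abs xs) \<and> abs ` set xs = {1..int n}}"

fun descents :: "int list \<Rightarrow> nat" where
  "descents (x # y # zs) = (if x > y then 1 else 0) + descents (y # zs)"
| "descents _ = 0"

definition negatives :: "int list \<Rightarrow> nat" where
  "negatives xs = length (filter (\<lambda>x. x < 0) xs)"

definition signed_word :: "nat \<Rightarrow> (int \<Rightarrow> int) \<Rightarrow> int list" where
  "signed_word n \<pi> = map (\<lambda>i. \<pi> (int i)) [1..<Suc n]"

lemma length_signed_words: "xs \<in> signed_words n \<Longrightarrow> length xs = n"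
  using distinct_card[of "map abs xs"] by (simp add: signed_words_def)

lemma descents_map_upt:
  "descents (map f [a..<Suc (a + n)]) = card {i \<in> {a..<a + n}. f i > f (Suc i)}"
proof (induction n arbitrary: a)
  case (Suc n)
  have "{i \<in> {a..<a + Suc n}. f i > f (Suc i)} =
    (if f a > f (Suc a) then {a} else {}) \<union> {i \<in> {Suc a..<Suc a + n}. f i > f (Suc i)}"
    by (auto simp: Suc_le_eq le_less)
  then have "card {i \<in> {a..<a + Suc n}. f i > f (Suc i)} =
    (if f a > f (Suc a) then 1 else 0) + card {i \<in> {Suc a..<Suc a + n}. f i > f (Suc i)}"
    by simp
  moreover have "[a..<Suc (a + Suc n)] = a # Suc a # [Suc (Suc a)..<Suc (Suc a + n)]"
    by (simp add: upt_conv_Cons)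
  moreover have "[Suc a..<Suc (Suc a + n)] = Suc a # [Suc (Suc a)..<Suc (Suc a + n)]"
    by (simp add: upt_conv_Cons)
  ultimately show ?case using Suc.IH[of "Suc a"] by (simp del: upt_Suc)
qed simp

lemma B_descents_eq_descents:
  assumes "\<pi> 0 = 0"
  shows "B_descents n \<pi> = descents (0 # signed_word n \<pi>)"
proof -
  have "0 # signed_word n \<pi> = map (\<lambda>i. \<pi> (int i)) [0..<Suc (0 + n)]"
    using assms by (simp add: signed_word_def upt_conv_Cons del: upt_Suc)
  then have "descents (0 # signed_word n \<pi>) = card {i \<in> {0..<n}. \<pi> (int i) > \<pi> (int (Suc i))}"
    using descents_map_upt[of "\<lambda>i. \<pi> (int i)" 0 n] by simp
  also have "\<dots> = card (int ` {i \<in> {0..<n}. \<pi> (int i) > \<pi> (int (Suc i))})"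
    by (simp add: card_image)
  also have "int ` {i \<in> {0..<n}. \<pi> (int i) > \<pi> (int (Suc i))} =
      {i \<in> {0..int n - 1}. \<pi> i > \<pi> (i + 1)}"
  proof (intro equalityI subsetI)
    fix i assume "i \<in> {i \<in> {0..int n - 1}. \<pi> i > \<pi> (i + 1)}"
    then show "i \<in> int ` {i \<in> {0..<n}. \<pi> (int i) > \<pi> (int (Suc i))}"
      by (intro image_eqI[of _ _ "nat i"]) (auto simp: add.commute)
  qed (auto simp: add.commute)
  finally show ?thesis by (simp add: B_descents_def)
qed

lemma neg_count_eq_negatives: "neg_count n \<pi> = negatives (signed_word n \<pi>)"
proof -
  have "negatives (signed_word n \<pi>) = length (filter (\<lambda>i. \<pi> (int i) < 0) [1..<Suc n])"
    by (simp add: negatives_def signed_word_def filter_map o_def del: upt_Suc)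
  also have "\<dots> = card {i \<in> {1..<Suc n}. \<pi> (int i) < 0}"
    by (subst distinct_card[symmetric]) (auto intro: arg_cong[of _ _ card])
  also have "\<dots> = card (int ` {i \<in> {1..<Suc n}. \<pi> (int i) < 0})"
    by (simp add: card_image)
  also have "int ` {i \<in> {1..<Suc n}. \<pi> (int i) < 0} = {i \<in> {1..int n}. \<pi> i < 0}"
  proof (intro equalityI subsetI)
    fix i assume "i \<in> {i \<in> {1..int n}. \<pi> i < 0}"
    then show "i \<in> int ` {i \<in> {1..<Suc n}. \<pi> (int i) < 0}"
      by (intro image_eqI[of _ _ "nat i"]) auto
  qed auto
  finally show ?thesis by (simp add: neg_count_def)
qed

lemma signed_word_in_signed_words:
  assumes "\<pi> \<in> signed_perms n"
  shows "signed_word n \<pi> \<in> signed_words n"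
proof -
  let ?D = "{- int n..int n} - {0}"
  have perm: "\<pi> permutes ?D" and odd: "\<And>i. i \<in> ?D \<Longrightarrow> \<pi> (- i) = - \<pi> i"
    using assms by (auto simp: signed_perms_def)
  have "inj_on (\<lambda>i. \<bar>\<pi> (int i)\<bar>) {1..<Suc n}"
  proof (rule inj_onI)
    fix i j assume ij: "i \<in> {1..<Suc n}" "j \<in> {1..<Suc n}" "\<bar>\<pi> (int i)\<bar> = \<bar>\<pi> (int j)\<bar>"
    then have "\<pi> (int i) = \<pi> (int j) \<or> \<pi> (int i) = \<pi> (- int j)"
      using odd[of "int j"] by (auto simp: abs_eq_iff)
    then have "int i = int j \<or> int i = - int j"
      using permutes_inj[OF perm] by (metis injD)
    then show "i = j" using ij by auto
  qed
  then have "distinct (map abs (signed_word n \<pi>))"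
    by (simp add: signed_word_def distinct_map comp_def del: upt_Suc)
  moreover have "abs ` set (signed_word n \<pi>) = {1..int n}"
  proof (intro equalityI subsetI)
    fix v assume "v \<in> abs ` set (signed_word n \<pi>)"
    then obtain i where i: "i \<in> {1..<Suc n}" "v = \<bar>\<pi> (int i)\<bar>"
      by (auto simp: signed_word_def simp del: upt_Suc)
    moreover have "\<pi> (int i) \<in> ?D"
      using i(1) permutes_in_image[OF perm, of "int i"] by auto
    ultimately show "v \<in> {1..int n}" by auto
  next
    fix v assume v: "v \<in> {1..int n}"
    then have "v \<in> \<pi> ` ?D" by (subst permutes_image[OF perm]) auto
    then obtain i where i: "i \<in> ?D" "v = \<pi> i" by blast
    have "v = \<bar>\<pi> (int (nat \<bar>i\<bar>))\<bar>"
      using i odd[OF i(1)] v by (cases "i \<ge> 0") auto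
    moreover have "nat \<bar>i\<bar> \<in> {1..<Suc n}" using i(1) by auto
    ultimately show "v \<in> abs ` set (signed_word n \<pi>)"
      unfolding signed_word_def set_map image_image set_upt by (rule image_eqI)
  qed
  ultimately show ?thesis by (simp add: signed_words_def)
qed

lemma inj_on_signed_word: "inj_on (signed_word n) (signed_perms n)"
proof (rule inj_onI)
  fix \<pi> \<rho>
  let ?D = "{- int n..int n} - {0}"
  assume \<pi>: "\<pi> \<in> signed_perms n" and \<rho>: "\<rho> \<in> signed_perms n"
    and eq: "signed_word n \<pi> = signed_word n \<rho>"
  have pos: "\<pi> i = \<rho> i" if "i \<in> {1..int n}" for i
  proof -
    have "\<forall>j\<in>set [1..<Suc n]. \<pi> (int j) = \<rho> (int j)"
      using eq unfolding signed_word_def map_eq_conv .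
    moreover have "nat i \<in> set [1..<Suc n]" using that by auto
    ultimately have "\<pi> (int (nat i)) = \<rho> (int (nat i))" by blast
    then show ?thesis using that by simp
  qed
  show "\<pi> = \<rho>"
  proof
    fix i
    consider "i \<notin> ?D" | "i \<in> {1..int n}" | "- i \<in> {1..int n}" by force
    then show "\<pi> i = \<rho> i"
    proof cases
      case 1
      then show ?thesis using \<pi> \<rho> unfolding signed_perms_def permutes_def by auto
    next
      case 2
      then show ?thesis by (rule pos)
    next
      case 3
      then have "- i \<in> ?D" by auto
      then have "\<pi> (- (- i)) = - \<pi> (- i)" "\<rho> (- (- i)) = - \<rho> (- i)"
        using \<pi> \<rho> unfolding signed_perms_def by blast+
      then show ?thesis using pos[OF 3] by simp
    qed
  qed
qed

text \<open>
  A word is extended to negative positions by oddness; the resulting map is injective on a finite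
  set and maps it into itself, hence it is a permutation.
\<close>
lemma signed_words_subset_image: "signed_words n \<subseteq> signed_word n ` signed_perms n"
proof
  fix xs assume xs: "xs \<in> signed_words n"
  let ?D = "{- int n..int n} - {0}"
  define \<pi> where "\<pi> i = (if i \<in> ?D then sgn i * xs ! (nat \<bar>i\<bar> - 1) else i)" for i
  have len: "length xs = n" using xs by (rule length_signed_words)
  have abs: "\<bar>\<pi> i\<bar> = map abs xs ! (nat \<bar>i\<bar> - 1)" "nat \<bar>i\<bar> - 1 < n" if "i \<in> ?D" for i
    using that len by (auto simp: \<pi>_def abs_mult abs_sgn_eq)
  have range: "\<bar>\<pi> i\<bar> \<in> {1..int n}" if "i \<in> ?D" for i
  proof -
    have "map abs xs ! (nat \<bar>i\<bar> - 1) \<in> set (map abs xs)"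
      using abs(2)[OF that] len by (intro nth_mem) simp
    then show ?thesis using xs abs(1)[OF that] by (simp add: signed_words_def)
  qed
  have odd: "\<pi> (- i) = - \<pi> i" if "i \<in> ?D" for i
    using that by (auto simp: \<pi>_def sgn_minus)
  have "inj_on \<pi> ?D"
  proof (rule inj_onI)
    fix i j assume i: "i \<in> ?D" and j: "j \<in> ?D" and eq: "\<pi> i = \<pi> j"
    have "nat \<bar>i\<bar> - 1 = nat \<bar>j\<bar> - 1"
      using xs eq abs[OF i] abs[OF j] len
        nth_eq_iff_index_eq[of "map abs xs" "nat \<bar>i\<bar> - 1" "nat \<bar>j\<bar> - 1"]
      by (simp add: signed_words_def)
    then have "i = j \<or> i = - j" using i j by auto
    then show "i = j" using odd[OF j] eq range[OF j] by auto
  qed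
  have closed: "\<pi> i \<in> ?D" if "i \<in> ?D" for i using range[OF that] by auto
  have "\<pi> ` ?D = ?D"
    by (intro endo_inj_surj \<open>inj_on \<pi> ?D\<close> image_subsetI closed) auto
  then have "bij_betw \<pi> ?D ?D"
    using \<open>inj_on \<pi> ?D\<close> by (simp only: bij_betw_def)
  moreover have "\<pi> i = i" if "i \<notin> ?D" for i
    using that unfolding \<pi>_def by (rule if_not_P)
  ultimately have "\<pi> permutes ?D" by (rule bij_imp_permutes)
  then have "\<pi> \<in> signed_perms n" using odd by (auto simp: signed_perms_def)
  moreover have "signed_word n \<pi> = xs"
    by (rule nth_equalityI) (auto simp: signed_word_def \<pi>_def len nat_add_distrib simp del: upt_Suc)
  ultimately show "xs \<in> signed_word n ` signed_perms n" by blast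
qed

lemma bij_betw_signed_word: "bij_betw (signed_word n) (signed_perms n) (signed_words n)"
  unfolding bij_betw_def
  using inj_on_signed_word signed_words_subset_image signed_word_in_signed_words by blast

lemma B_poly_eq_sum_words:
  "B_poly t n = (\<Sum>xs\<in>signed_words n. monom (t ^ negatives xs) (descents (0 # xs)))"
  unfolding B_poly_def sum.reindex_bij_betw[OF bij_betw_signed_word, symmetric]
  by (intro sum.cong refl)
     (simp add: B_descents_eq_descents signed_perms_at_0 neg_count_eq_negatives)

section \<open>Inserting the largest letter\<close>

definition insert_at :: "'a \<Rightarrow> nat \<Rightarrow> 'a list \<Rightarrow> 'a list" where
  "insert_at v i xs = take i xs @ v # drop i xs"

lemma mset_insert_at: "mset (insert_at v i xs) = add_mset v (mset xs)"
proof -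
  have "mset (take i xs) + mset (drop i xs) = mset xs"
    by (metis append_take_drop_id mset_append)
  then show ?thesis by (simp add: insert_at_def)
qed

lemma insert_at_in_signed_words_iff:
  assumes "\<bar>v\<bar> = int (Suc n)"
  shows "insert_at v i xs \<in> signed_words (Suc n) \<longleftrightarrow> xs \<in> signed_words n"
proof -
  have m: "mset (map abs (insert_at v i xs)) = mset (map abs (v # xs))"
    by (simp add: mset_insert_at)
  have d: "distinct (map abs (insert_at v i xs)) \<longleftrightarrow> distinct (map abs (v # xs))"
    using m by (rule mset_eq_imp_distinct_iff)
  have s: "abs ` set (insert_at v i xs) = insert (int (Suc n)) (abs ` set xs)"
    using mset_eq_setD[OF m] assms by simp
  have "{1..int (Suc n)} = insert (int (Suc n)) {1..int n}" by auto
  moreover have notin: "int (Suc n) \<notin> {1..int n}" by simp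
  ultimately have "abs ` set (insert_at v i xs) = {1..int (Suc n)} \<longleftrightarrow> abs ` set xs = {1..int n}"
    if "int (Suc n) \<notin> abs ` set xs"
    unfolding s by (simp only: insert_ident[OF that notin])
  moreover have "distinct (map abs (v # xs)) \<longleftrightarrow>
      int (Suc n) \<notin> abs ` set xs \<and> distinct (map abs xs)"
    using assms by (simp only: list.map distinct.simps set_map)
  ultimately show ?thesis
    unfolding signed_words_def mem_Collect_eq d using notin by metis
qed

text \<open>
  The insertion position can be recovered because the inserted letter is the only one of absolute
  value \<open>m\<close>: the part before it is the longest prefix without such a letter.
\<close>
lemma insert_at_eq_iff:
  assumes "\<bar>v\<bar> = m" "\<bar>w\<bar> = m" "m \<notin> abs ` set xs" "m \<notin> abs ` set ys"
    and "i \<le> length xs" "j \<le> length ys"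
  shows "insert_at (v::int) i xs = insert_at w j ys \<longleftrightarrow> v = w \<and> i = j \<and> xs = ys"
proof
  assume eq: "insert_at v i xs = insert_at w j ys"
  have "takeWhile (\<lambda>x. \<bar>x\<bar> \<noteq> m) (insert_at u k zs) = take k zs"
    if "\<bar>u\<bar> = m" "m \<notin> abs ` set zs" for u :: int and k zs
  proof -
    have "takeWhile (\<lambda>x. \<bar>x\<bar> \<noteq> m) (take k zs @ u # drop k zs) =
        take k zs @ takeWhile (\<lambda>x. \<bar>x\<bar> \<noteq> m) (u # drop k zs)"
      using that by (intro takeWhile_append2) (metis image_eqI in_set_takeD)
    then show ?thesis using that by (simp add: insert_at_def)
  qed
  then have t: "take i xs = take j ys" using eq assms by metis
  then have "length (take i xs) = length (take j ys)" by simp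
  then have "i = j" using assms by simp
  moreover have "v = w" "drop i xs = drop j ys" using eq t by (simp_all add: insert_at_def)
  ultimately show "v = w \<and> i = j \<and> xs = ys" using t by (metis append_take_drop_id)
qed auto

lemma bij_betw_insert_largest:
  "bij_betw (\<lambda>(xs, v, i). insert_at v i xs)
     (signed_words n \<times> {int (Suc n), - int (Suc n)} \<times> {..n}) (signed_words (Suc n))"
proof -
  let ?V = "{int (Suc n), - int (Suc n)}" and ?f = "\<lambda>(xs, v, i). insert_at v i xs"
  have V: "v \<in> ?V \<longleftrightarrow> \<bar>v\<bar> = int (Suc n)" for v by auto
  have notin: "int (Suc n) \<notin> abs ` set xs" if "xs \<in> signed_words n" for xs
    using that by (simp add: signed_words_def)
  have "inj_on ?f (signed_words n \<times> ?V \<times> {..n})"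
  proof (rule inj_onI)
    fix a b
    assume ab: "a \<in> signed_words n \<times> ?V \<times> {..n}" "b \<in> signed_words n \<times> ?V \<times> {..n}"
      and eq: "?f a = ?f b"
    obtain xs v i ys w j where "a = (xs, v, i)" "b = (ys, w, j)" by (metis prod_cases3)
    then show "a = b"
      using ab eq insert_at_eq_iff[of v "int (Suc n)" w xs ys i j] notin[of xs] notin[of ys]
        length_signed_words[of xs n] length_signed_words[of ys n]
      unfolding mem_Times_iff V by simp
  qed
  moreover have "?f ` (signed_words n \<times> ?V \<times> {..n}) \<subseteq> signed_words (Suc n)"
    unfolding image_subset_iff by (auto simp only: mem_Times_iff V insert_at_in_signed_words_iff split: prod.splits)
  moreover have "signed_words (Suc n) \<subseteq> ?f ` (signed_words n \<times> ?V \<times> {..n})"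
  proof
    fix ys assume ys: "ys \<in> signed_words (Suc n)"
    then have "int (Suc n) \<in> abs ` set ys" unfolding signed_words_def by auto
    then obtain v where v: "v \<in> set ys" "\<bar>v\<bar> = int (Suc n)" by auto
    then obtain as bs where "ys = as @ v # bs" by (meson split_list)
    then have eq: "ys = insert_at v (length as) (as @ bs)" by (simp add: insert_at_def)
    then have xs: "as @ bs \<in> signed_words n"
      using ys insert_at_in_signed_words_iff[OF v(2)] by simp
    then have "length as \<le> n" using length_signed_words[OF xs] by simp
    then have "(as @ bs, v, length as) \<in> signed_words n \<times> ?V \<times> {..n}"
      using xs v(2) unfolding mem_Times_iff V by simp
    then show "ys \<in> ?f ` (signed_words n \<times> ?V \<times> {..n})" using eq by (intro image_eqI) auto
  qed
  ultimately show ?thesis by (simp add: bij_betw_def subset_antisym)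
qed

text \<open>
  A letter larger than all others, put into a gap between two neighbours, creates a descent to its
  right and none to its left. So a gap that was a descent keeps the number of descents, a gap that
  was an ascent raises it by one, and the final position keeps it. The first letter \<open>y\<close> stands for
  the value \<open>\<pi> 0\<close>; it is arbitrary to make the induction work.
\<close>
lemma sum_insert_positive:
  assumes "y < v" "\<forall>x\<in>set xs. x < v"
  shows "(\<Sum>i\<le>length xs. monom (1::real) (descents (y # insert_at v i xs))) =
    monom (1 + real (descents (y # xs))) (descents (y # xs)) +
    monom (real (length xs) - real (descents (y # xs))) (Suc (descents (y # xs)))"
  using assms
proof (induction xs arbitrary: y)
  case (Cons x xs)
  have "(\<Sum>i\<le>length (x # xs). monom (1::real) (descents (y # insert_at v i (x # xs)))) =
    monom 1 (Suc (descents (x # xs))) +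
    monom 1 (if y > x then 1 else 0) *
      (\<Sum>i\<le>length xs. monom 1 (descents (x # insert_at v i xs)))"
    using Cons.prems
    by (simp add: sum.atMost_Suc_shift insert_at_def sum_distrib_left mult_monom del: sum.atMost_Suc)
  
  also have "\<dots> = monom (1 + real (descents (y # x # xs))) (descents (y # x # xs)) +
      monom (real (length (x # xs)) - real (descents (y # x # xs))) (Suc (descents (y # x # xs)))"
    using Cons by (simp add: distrib_left mult_monom add_monom algebra_simps)
  finally show ?case .
qed (simp add: insert_at_def)

text \<open>
  A letter smaller than all others creates a descent to its left and none to its right. The gaps
  behave as for the largest letter, but at the final position the number of descents now grows.
\<close>
lemma sum_insert_negative:
  assumes "v < y" "\<forall>x\<in>set xs. v < x"
  shows "(\<Sum>i\<le>length xs. monom (1::real) (descents (y # insert_at v i xs))) =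
    monom (real (descents (y # xs))) (descents (y # xs)) +
    monom (real (length xs) - real (descents (y # xs)) + 1) (Suc (descents (y # xs)))"
  using assms
proof (induction xs arbitrary: y)
  case (Cons x xs)
  have "(\<Sum>i\<le>length (x # xs). monom (1::real) (descents (y # insert_at v i (x # xs)))) =
    monom 1 (Suc (descents (x # xs))) +
    monom 1 (if y > x then 1 else 0) *
      (\<Sum>i\<le>length xs. monom 1 (descents (x # insert_at v i xs)))"
    using Cons.prems
    by (simp add: sum.atMost_Suc_shift insert_at_def sum_distrib_left mult_monom del: sum.atMost_Suc)
  also have "\<dots> = monom (real (descents (y # x # xs))) (descents (y # x # xs)) +
      monom (real (length (x # xs)) - real (descents (y # x # xs)) + 1) (Suc (descents (y # x # xs)))"
    using Cons by (simp add: distrib_left mult_monom add_monom algebra_simps)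
  finally show ?case .
qed (simp add: insert_at_def)

lemma smult_sum_right: "smult a (sum f A) = (\<Sum>x\<in>A. smult a (f x))"
  by (induction A rule: infinite_finite_induct) (simp_all add: smult_add_right)

lemma pderiv_sum: "pderiv (sum f A) = (\<Sum>x\<in>A. pderiv (f x))"
  by (induction A rule: infinite_finite_induct) (simp_all add: pderiv_add)

lemma negatives_insert_at:
  "negatives (insert_at v i xs) = (if v < 0 then 1 else 0) + negatives xs"
  using arg_cong[OF mset_insert_at, of "\<lambda>M. size (filter_mset (\<lambda>x. x < 0) M)" v i xs]
  unfolding negatives_def by (simp flip: mset_filter)

text \<open>
  For a word with \<open>d\<close> descents, summing over the insertions of \<open>\<plusminus>(n + 1)\<close> replaces \<open>q\<^sup>d\<close>
  by \<open>(1 + d + t d) q\<^sup>d + (n - d + t (n - d + 1)) q\<^bsup>d + 1\<^esup>\<close>. The coefficients are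
  linear in \<open>d\<close>, hence this is a first-order differential operator applied to \<open>q\<^sup>d\<close>.
\<close>
lemma B_poly_recurrence:
  "B_poly t (Suc n) = [:1, (1 + t) * real n + t:] * B_poly t n
     + [:0, 1 + t, - (1 + t):] * pderiv (B_poly t n)"
proof -
  let ?V = "{int (Suc n), - int (Suc n)}"
  let ?w = "\<lambda>xs. monom (t ^ negatives xs) (descents (0 # xs))"
  have inner: "(\<Sum>(v, i)\<in>?V \<times> {..n}. ?w (insert_at v i xs)) =
      [:1, (1 + t) * real n + t:] * ?w xs + [:0, 1 + t, - (1 + t):] * pderiv (?w xs)"
    if xs: "xs \<in> signed_words n" for xs
  proof -
    define d where "d = descents (0 # xs)"
    have bounds: "\<forall>x\<in>set xs. x < int (Suc n)" "\<forall>x\<in>set xs. - int (Suc n) < x"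
      using xs by (force simp: signed_words_def)+
    have factor: "?w (insert_at v i xs) = smult (t ^ ((if v < 0 then 1 else 0) + negatives xs))
        (monom 1 (descents (0 # insert_at v i xs)))" for v i
      by (simp add: negatives_insert_at smult_monom)
    have "(\<Sum>(v, i)\<in>?V \<times> {..n}. ?w (insert_at v i xs)) =
        (\<Sum>v\<in>?V. \<Sum>i\<le>n. ?w (insert_at v i xs))"
      by (rule sum.cartesian_product[symmetric])
    also have "\<dots> = (\<Sum>i\<le>n. ?w (insert_at (int (Suc n)) i xs))
        + (\<Sum>i\<le>n. ?w (insert_at (- int (Suc n)) i xs))"
      by simp
    also have "\<dots> = smult (t ^ negatives xs)
        (monom (1 + real d) d + monom (real n - real d) (Suc d))
      + smult (t ^ Suc (negatives xs))
        (monom (real d) d + monom (real n - real d + 1) (Suc d))"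
      unfolding factor smult_sum_right[symmetric]
      using sum_insert_positive[of 0 "int (Suc n)" xs] sum_insert_negative[of "- int (Suc n)" 0 xs]
        bounds length_signed_words[OF xs]
      by (simp add: d_def del: of_nat_Suc)
    also have "\<dots> = [:1, (1 + t) * real n + t:] * ?w xs + [:0, 1 + t, - (1 + t):] * pderiv (?w xs)"
      unfolding d_def[symmetric]
      by (rule poly_eqI, cases d) (auto simp: coeff_pCons pderiv_monom algebra_simps split: nat.splits)
    finally show ?thesis .
  qed
  have "B_poly t (Suc n) = (\<Sum>(xs, v, i)\<in>signed_words n \<times> ?V \<times> {..n}. ?w (insert_at v i xs))"
    unfolding B_poly_eq_sum_words sum.reindex_bij_betw[OF bij_betw_insert_largest, symmetric]
    by (simp add: split_def)
  also have "\<dots> = (\<Sum>xs\<in>signed_words n. \<Sum>(v, i)\<in>?V \<times> {..n}. ?w (insert_at v i xs))"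
    by (simp add: sum.cartesian_product split_def)
  also have "\<dots> = (\<Sum>xs\<in>signed_words n. [:1, (1 + t) * real n + t:] * ?w xs
      + [:0, 1 + t, - (1 + t):] * pderiv (?w xs))"
    by (intro sum.cong refl inner)
  also have "\<dots> = [:1, (1 + t) * real n + t:] * B_poly t n
     + [:0, 1 + t, - (1 + t):] * pderiv (B_poly t n)"
    unfolding B_poly_eq_sum_words sum.distrib sum_distrib_left[symmetric] pderiv_sum ..
  finally show ?thesis .
qed

lemma B_poly_eq_jacobi_moment: "B_poly t n = jacobi_triangle (B_diag t) (B_offdiag t) n 0"
proof (induction n)
  case 0
  show ?case by (simp add: B_poly_0)
next
  case (Suc n)
  then show ?case unfolding B_triangle_recurrence B_poly_recurrence by simp
qed

theorem proposition3p4: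
  fixes t :: real
  assumes "t \<ge> 0"
  shows "strongly_q_log_convex (\<lambda>n. B_poly t n)"
  unfolding B_poly_eq_jacobi_moment
proof (rule jacobi_moments_strongly_q_log_convex)
  fix k
  show "nonneg_coeffs (B_diag t k)" "nonneg_coeffs (B_offdiag t k)"
    using assms by (simp_all add: B_diag_def B_offdiag_def)
  define c where "c = 1 + t"
  define x where "x = real k"
  have nn: "0 \<le> x" "0 \<le> c" using assms by (auto simp: x_def c_def)
  have diag: "B_diag t k = [:x * c + 1, x * c + t:]"
    "B_diag t (Suc k) = [:(x + 1) * c + 1, (x + 1) * c + t:]"
    by (simp_all add: B_diag_def x_def c_def add.commute)
  have offdiag: "B_offdiag t k = [:0, ((x + 1) * c)\<^sup>2:]"
    by (simp add: B_offdiag_def x_def c_def add.commute)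
  have "(x * c + 1) * ((x + 1) * c + t) + (x * c + t) * ((x + 1) * c + 1) - ((x + 1) * c)\<^sup>2 =
      c\<^sup>2 * (x\<^sup>2 + 2 * x) + 2 * t"
    by (simp add: c_def power2_eq_square algebra_simps)
  also have "\<dots> \<ge> 0" using nn assms by simp
  finally have mid: "0 \<le> (x * c + 1) * ((x + 1) * c + t) + (x * c + t) * ((x + 1) * c + 1)
      - ((x + 1) * c)\<^sup>2" .
  have "B_diag t k * B_diag t (Suc k) - B_offdiag t k =
    [:(x * c + 1) * ((x + 1) * c + 1),
      (x * c + 1) * ((x + 1) * c + t) + (x * c + t) * ((x + 1) * c + 1) - ((x + 1) * c)\<^sup>2,
      (x * c + t) * ((x + 1) * c + t):]"
    unfolding diag offdiag by (simp add: algebra_simps)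
  also have "nonneg_coeffs \<dots>"
    using nn assms mid by simp
  finally show "nonneg_coeffs (B_diag t k * B_diag t (Suc k) - B_offdiag t k)" .
qed

end
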